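(* Let $X$ be non-empty and let $(X,\mathcal{T}_1,\mathcal{T}_2,E)$ be a bi-soft topological space over $X$. If $(X,\mathcal{T}_1,\mathcal{T}_2,E)$ is a pair-wise soft $T_2$-space over $X$, then $(X,\mathcal{T}_{1e},\mathcal{T}_{2e})$ is a pair-wise $T_2$-space for each $e\in E$.
   Context: $X$ is the initial universe and $E$ is a non-empty set of parameters. A soft set $(F,E)$ over $X$ is a map $F:E\to\mathcal{P}(X)$, where $\mathcal{P}(X)$ is the power set of $X$. Unions and intersections of soft sets are taken parameterwise. $\Phi$ denotes the soft set with value $\emptyset$ at every $e\in E$ and $\widetilde{X}$ the soft set with value $X$ at every $e\in E$. For $x\in X$, $x\in(F,E)$ means $x\in F(e)$ for all $e\in E$. A soft topology on $X$ is a collection $\mathcal{T}$ of soft sets over $X$ (with parameter set $E$) containing $\Phi$ and $\widetilde{X}$ and closed under arbitrary unions and under intersections of two members; its members are called soft open. A bi-soft topological space $(X,\mathcal{T}_1,\mathcal{T}_2,E)$ consists of two soft topologies $\mathcal{T}_1,\mathcal{T}_2$ on $X$ with the same parameter set $E$. For $e\in E$ and $i=1,2$, $\mathcal{T}_{ie}=\{F(e)\mid(F,E)\in\mathcal{T}_i\}$, which is a topology on $X$. A bitopological space is a non-empty set with two topologies. $(X,\mathcal{T}_1,\mathcal{T}_2,E)$ is pair-wise soft $T_2$ (pair-wise soft Hausdorff) if for all $x,y\in X$ with $x\ne y$ there are $(F,E)\in\mathcal{T}_1$ and $(G,E)\in\mathcal{T}_2$ with $x\in(F,E)$, $y\in(G,E)$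 and $(F,E)\cap(G,E)=\Phi$. A bitopological space $(X,\mathcal{P},\mathcal{Q})$ is pair-wise $T_2$ if for all distinct $x,y\in X$ there exist $U\in\mathcal{P}$, $V\in\mathcal{Q}$ with $x\in U$, $y\in V$, $U\cap V=\emptyset$. *)

theory Defs
  imports "HOL-Analysis.Analysis"
begin

(* A soft set over X with parameter set E is a map E -> Pow X.  Restricting to extensional
   functions makes HOL equality of soft sets coincide with equality of maps on E. *)
definition soft_sets :: "'a set \<Rightarrow> 'e set \<Rightarrow> ('e \<Rightarrow> 'a set) set" where
  "soft_sets X E = (E \<rightarrow>\<^sub>E Pow X)"

definition soft_const :: "'e set \<Rightarrow> 'a set \<Rightarrow> 'e \<Rightarrow> 'a set" where
  "soft_const E A = (\<lambda>e\<in>E. A)"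

abbreviation soft_empty :: "'e set \<Rightarrow> 'e \<Rightarrow> 'a set" where
  "soft_empty E \<equiv> soft_const E {}"

abbreviation soft_univ :: "'e set \<Rightarrow> 'a set \<Rightarrow> 'e \<Rightarrow> 'a set" where
  "soft_univ E X \<equiv> soft_const E X"

definition soft_inter :: "'e set \<Rightarrow> ('e \<Rightarrow> 'a set) \<Rightarrow> ('e \<Rightarrow> 'a set) \<Rightarrow> 'e \<Rightarrow> 'a set" where
  "soft_inter E F G = (\<lambda>e\<in>E. F e \<inter> G e)"

definition soft_Union :: "'e set \<Rightarrow> ('e \<Rightarrow> 'a set) set \<Rightarrow> 'e \<Rightarrow> 'a set" where
  "soft_Union E \<F> = (\<lambda>e\<in>E. \<Union>F\<in>\<F>. F e)"

definition soft_mem :: "'e set \<Rightarrow> 'a \<Rightarrow> ('e \<Rightarrow> 'a set) \<Rightarrow> bool" where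
  "soft_mem E x F \<longleftrightarrow> (\<forall>e\<in>E. x \<in> F e)"

definition soft_topology :: "'a set \<Rightarrow> 'e set \<Rightarrow> ('e \<Rightarrow> 'a set) set \<Rightarrow> bool" where
  "soft_topology X E \<T> \<longleftrightarrow>
     \<T> \<subseteq> soft_sets X E \<and>
     soft_empty E \<in> \<T> \<and> soft_univ E X \<in> \<T> \<and>
     (\<forall>\<F>\<subseteq>\<T>. soft_Union E \<F> \<in> \<T>) \<and>
     (\<forall>F\<in>\<T>. \<forall>G\<in>\<T>. soft_inter E F G \<in> \<T>)"

definition bisoft_topological_space ::
  "'a set \<Rightarrow> ('e \<Rightarrow> 'a set) set \<Rightarrow> ('e \<Rightarrow> 'a set) set \<Rightarrow> 'e set \<Rightarrow> bool" where
  "bisoft_topological_space X \<T>\<^sub>1 \<T>\<^sub>2 E \<longleftrightarrow>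
     E \<noteq> {} \<and> soft_topology X E \<T>\<^sub>1 \<and> soft_topology X E \<T>\<^sub>2"

definition pairwise_soft_T2 ::
  "'a set \<Rightarrow> ('e \<Rightarrow> 'a set) set \<Rightarrow> ('e \<Rightarrow> 'a set) set \<Rightarrow> 'e set \<Rightarrow> bool" where
  "pairwise_soft_T2 X \<T>\<^sub>1 \<T>\<^sub>2 E \<longleftrightarrow>
     bisoft_topological_space X \<T>\<^sub>1 \<T>\<^sub>2 E \<and>
     (\<forall>x\<in>X. \<forall>y\<in>X. x \<noteq> y \<longrightarrow>
        (\<exists>F\<in>\<T>\<^sub>1. \<exists>G\<in>\<T>\<^sub>2. soft_mem E x F \<and> soft_mem E y G \<and> soft_inter E F G = soft_empty E))"

definition param_topology :: "('e \<Rightarrow> 'a set) set \<Rightarrow> 'e \<Rightarrow> 'a set set" where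
  "param_topology \<T> e = {F e | F. F \<in> \<T>}"

(* istopology already yields the empty set and closure under unions and binary intersections;
   the condition on the union then makes X the underlying set (and X open). *)
definition topology_on :: "'a set \<Rightarrow> 'a set set \<Rightarrow> bool" where
  "topology_on X \<P> \<longleftrightarrow> istopology (\<lambda>U. U \<in> \<P>) \<and> \<Union>\<P> = X"

definition bitopological_space :: "'a set \<Rightarrow> 'a set set \<Rightarrow> 'a set set \<Rightarrow> bool" where
  "bitopological_space X \<P> \<Q> \<longleftrightarrow> X \<noteq> {} \<and> topology_on X \<P> \<and> topology_on X \<Q>"

definition pairwise_T2 :: "'a set \<Rightarrow> 'a set set \<Rightarrow> 'a set set \<Rightarrow> bool" where
  "pairwise_T2 X \<P> \<Q> \<longleftrightarrow>
     bitopological_space X \<P> \<Q> \<and>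
     (\<forall>x\<in>X. \<forall>y\<in>X. x \<noteq> y \<longrightarrow>
        (\<exists>U\<in>\<P>. \<exists>V\<in>\<Q>. x \<in> U \<and> y \<in> V \<and> U \<inter> V = {}))"

end

theory Submission
  imports Defs
begin

text \<open>
  Evaluation at a fixed parameter \<open>e\<close> commutes with unions and binary intersections of soft sets,
  and sends the null and absolute soft sets to \<open>{}\<close> and \<open>X\<close>; hence it carries a soft topology
  on \<open>X\<close> to a topology on \<open>X\<close> (\<open>topology_on_param_topology\<close>). Soft membership and soft disjointness
  are required at every parameter, in particular at \<open>e\<close>, so the values at \<open>e\<close> of soft open sets
  separating two points separate them in the bitopological space at \<open>e\<close>.
\<close>

lemma istopology_param_topology:
  assumes T: "soft_topology X E \<T>" and e: "e \<in> E"
  shows "istopology (\<lambda>U. U \<in> param_topology \<T> e)"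
  unfolding istopology_def
proof (intro conjI allI impI)
  fix U V
  assume "U \<in> param_topology \<T> e" "V \<in> param_topology \<T> e"
  then obtain F G where FG: "F \<in> \<T>" "G \<in> \<T>" "U = F e" "V = G e"
    by (auto simp: param_topology_def)
  then have "soft_inter E F G \<in> \<T>"
    using T by (auto simp: soft_topology_def)
  moreover have "U \<inter> V = soft_inter E F G e"
    using FG e by (simp add: soft_inter_def)
  ultimately show "U \<inter> V \<in> param_topology \<T> e"
    by (auto simp: param_topology_def)
next
  fix K
  assume K: "\<forall>U\<in>K. U \<in> param_topology \<T> e"
  \<comment> \<open>Taking every soft open set whose value lies in \<open>K\<close> avoids choosing one for each member
    of \<open>K\<close>.\<close>
  define \<F> where "\<F> = {F \<in> \<T>. F e \<in> K}"
  have "K = (\<lambda>F. F e) ` \<F>"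
    using K by (auto simp: \<F>_def param_topology_def)
  then have "\<Union>K = soft_Union E \<F> e"
    using e by (simp add: soft_Union_def)
  moreover have "soft_Union E \<F> \<in> \<T>"
    using T by (auto simp: soft_topology_def \<F>_def)
  ultimately show "\<Union>K \<in> param_topology \<T> e"
    by (auto simp: param_topology_def)
qed

lemma topology_on_param_topology:
  assumes T: "soft_topology X E \<T>" and e: "e \<in> E"
  shows "topology_on X (param_topology \<T> e)"
proof -
  have "F e \<subseteq> X" if "F \<in> \<T>" for F
    using T that e by (auto simp: soft_topology_def soft_sets_def)
  moreover have "X \<in> param_topology \<T> e"
    unfolding param_topology_def
    using T e by (auto simp: soft_topology_def soft_const_def intro!: exI[of _ "soft_univ E X"])
  ultimately have "\<Union>(param_topology \<T> e) = X"
    by (auto simp: param_topology_def)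
  then show ?thesis
    using istopology_param_topology[OF T e] by (simp add: topology_on_def)
qed

theorem proposition12:
  fixes X :: "'a set" and E :: "'e set"
    and \<T>\<^sub>1 \<T>\<^sub>2 :: "('e \<Rightarrow> 'a set) set"
  assumes "X \<noteq> {}"
    and "bisoft_topological_space X \<T>\<^sub>1 \<T>\<^sub>2 E"
    and "pairwise_soft_T2 X \<T>\<^sub>1 \<T>\<^sub>2 E"
  shows "\<forall>e\<in>E. pairwise_T2 X (param_topology \<T>\<^sub>1 e) (param_topology \<T>\<^sub>2 e)"
proof
  fix e assume e: "e \<in> E"
  have "bitopological_space X (param_topology \<T>\<^sub>1 e) (param_topology \<T>\<^sub>2 e)"
    using assms(1,2) topology_on_param_topology[OF _ e]
    by (auto simp: bitopological_space_def bisoft_topological_space_def)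
  moreover have "\<exists>U\<in>param_topology \<T>\<^sub>1 e. \<exists>V\<in>param_topology \<T>\<^sub>2 e. x \<in> U \<and> y \<in> V \<and> U \<inter> V = {}"
    if xy: "x \<in> X" "y \<in> X" "x \<noteq> y" for x y
  proof -
    obtain F G where FG: "F \<in> \<T>\<^sub>1" "G \<in> \<T>\<^sub>2" "soft_mem E x F" "soft_mem E y G"
      and disj: "soft_inter E F G = soft_empty E"
      using assms(3) xy unfolding pairwise_soft_T2_def by blast
    have "F e \<inter> G e = {}"
      using fun_cong[OF disj, of e] e by (simp add: soft_inter_def soft_const_def)
    moreover have "x \<in> F e" "y \<in> G e"
      using FG e by (auto simp: soft_mem_def)
    moreover have "F e \<in> param_topology \<T>\<^sub>1 e" "G e \<in> param_topology \<T>\<^sub>2 e"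
      using FG by (auto simp: param_topology_def)
    ultimately show ?thesis by blast
  qed
  ultimately show "pairwise_T2 X (param_topology \<T>\<^sub>1 e) (param_topology \<T>\<^sub>2 e)"
    by (simp add: pairwise_T2_def)
qed

end
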